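(* Let $n,d\ge1$ be integers and let $(A,B,C)$ be a bilinear algorithm for 1D linear convolution of $n$-dimensional vectors. Let $f,g\in\mathbb{R}^{n^d}$ and let $\delta f,\delta g$ be perturbations with $\|\delta f\|\le\varepsilon\|f\|$ and $\|\delta g\|\le\varepsilon\|g\|$. Then the convolution of $f$ and $g$ computed by nesting $(A,B,C)$ over $d$ levels with the overlap-add method has error $\delta y$ satisfying $$\|\delta y\|\le 2^{d/2+1}\cdot\|C\|^d\cdot\|A\|^d\cdot\|B\|^d\cdot\|f\|\cdot\|g\|\cdot\varepsilon+O(\varepsilon^2),$$ where $\|\cdot\|$ is the 2-norm.
   Context: All indices start at $0$. Linear convolution of $f,g\in\mathbb{C}^n$ is $f*g\in\mathbb{C}^{2n-1}$ with $(f*g)_k=\sum_i f_ig_{k-i}$ (sum over all $i$ for which both indices are in range). A bilinear algorithm for linear convolution of $n$-dimensional vectors is a triple $A,B\in\mathbb{C}^{n\times R}$, $C\in\mathbb{C}^{(2n-1)\times R}$ with $f*g=C[(A^{\mathsf T}f)\odot(B^{\mathsf T}g)]$ for all $f,g$, where $\odot$ is the entrywise product. Overlap-add recomposition matrix: for $\gamma,\eta\ge1$, $Q^{(\gamma,\eta)}\in\mathbb{R}^{(2\gamma\eta-1)\times(2\gamma-1)(2\eta-1)}$ has entries $q^{(\gamma,\eta)}_{ij}=1$ if $i=j-(\eta-1)\lfloor j/(2\eta-1)\rfloor$ and $0$ otherwise. Nesting by overlap-add: a bilinear algorithm $(A_d,B_d,C_d)$ for linear convolution of $n^d$-dimensional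 vectors is built by $(A_1,B_1,C_1)=(A,B,C)$ and, for $k\ge2$, $A_k=A\otimes A_{k-1}$, $B_k=B\otimes B_{k-1}$, $C_k=Q^{(n,n^{k-1})}(C\otimes C_{k-1})$, where $\otimes$ is the Kronecker product. The nested algorithm computes $y(f,g)=C_d[(A_d^{\mathsf T}f)\odot(B_d^{\mathsf T}g)]$, and $\delta y=y(f+\delta f,g+\delta g)-y(f,g)$. For vectors $\|\cdot\|$ is the Euclidean norm and for matrices it is the induced (spectral) norm. The $O(\varepsilon^2)$ term is as $\varepsilon\to0$, with a constant that may depend on $A,B,C,d,f,g$ but not on $\varepsilon,\delta f,\delta g$. *)

theory Defs
  imports
    "Jordan_Normal_Form.Matrix"
    "HOL-Analysis.L2_Norm"
    "HOL-Library.Landau_Symbols"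
begin

definition vec_norm2 :: "'a :: real_normed_vector vec \<Rightarrow> real" where
  "vec_norm2 v = L2_set (\<lambda>i. norm (v $ i)) {..<dim_vec v}"

text \<open>Taking the supremum over the closed unit ball (which contains the zero vector) keeps the
  set nonempty even for matrices without columns.\<close>

definition spectral_norm :: "complex mat \<Rightarrow> real" where
  "spectral_norm A = (SUP v\<in>{v \<in> carrier_vec (dim_col A). vec_norm2 v \<le> 1}. vec_norm2 (A *\<^sub>v v))"

definition lin_conv :: "nat \<Rightarrow> complex vec \<Rightarrow> complex vec \<Rightarrow> complex vec" where
  "lin_conv n f g = vec (2 * n - 1) (\<lambda>k. \<Sum>i | i < n \<and> i \<le> k \<and> k - i < n. f $ i * g $ (k - i))"

definition hadamard :: "'a :: times vec \<Rightarrow> 'a vec \<Rightarrow> 'a vec" (infixl "\<odot>" 70) where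
  "u \<odot> v = vec (dim_vec u) (\<lambda>i. u $ i * v $ i)"

definition bilinear_eval ::
  "complex mat \<Rightarrow> complex mat \<Rightarrow> complex mat \<Rightarrow> complex vec \<Rightarrow> complex vec \<Rightarrow> complex vec" where
  "bilinear_eval A B C f g = C *\<^sub>v ((transpose_mat A *\<^sub>v f) \<odot> (transpose_mat B *\<^sub>v g))"

definition lin_conv_algorithm ::
  "nat \<Rightarrow> nat \<Rightarrow> complex mat \<Rightarrow> complex mat \<Rightarrow> complex mat \<Rightarrow> bool" where
  "lin_conv_algorithm n R A B C \<longleftrightarrow>
     A \<in> carrier_mat n R \<and> B \<in> carrier_mat n R \<and> C \<in> carrier_mat (2 * n - 1) R \<and>
     (\<forall>f \<in> carrier_vec n. \<forall>g \<in> carrier_vec n. lin_conv n f g = bilinear_eval A B C f g)"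

definition kronecker :: "'a :: times mat \<Rightarrow> 'a mat \<Rightarrow> 'a mat" (infixr "\<otimes>\<^sub>K" 70) where
  "A \<otimes>\<^sub>K B = mat (dim_row A * dim_row B) (dim_col A * dim_col B)
     (\<lambda>(i, j). A $$ (i div dim_row B, j div dim_col B) * B $$ (i mod dim_row B, j mod dim_col B))"

text \<open>The subtraction in the row index never truncates:
  \<open>(\<eta> - 1) * (j div (2 * \<eta> - 1)) \<le> j\<close>.\<close>

definition overlap_add_mat :: "nat \<Rightarrow> nat \<Rightarrow> 'a :: {zero, one} mat" where
  "overlap_add_mat \<gamma> \<eta> = mat (2 * \<gamma> * \<eta> - 1) ((2 * \<gamma> - 1) * (2 * \<eta> - 1))
     (\<lambda>(i, j). if i = j - (\<eta> - 1) * (j div (2 * \<eta> - 1)) then 1 else 0)"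

text \<open>The nesting recursion starts at level \<open>1\<close>; the value at level \<open>0\<close> is a convention only.
  In the last equation the level is \<open>k + 2\<close>, so the lower level \<open>k + 1\<close> handles vectors of
  dimension \<open>n ^ (k + 1)\<close>.\<close>

fun nested_in :: "complex mat \<Rightarrow> nat \<Rightarrow> complex mat" where
  "nested_in A 0 = 1\<^sub>m 1"
| "nested_in A (Suc 0) = A"
| "nested_in A (Suc (Suc k)) = A \<otimes>\<^sub>K nested_in A (Suc k)"

fun nested_out :: "nat \<Rightarrow> complex mat \<Rightarrow> nat \<Rightarrow> complex mat" where
  "nested_out n C 0 = 1\<^sub>m 1"
| "nested_out n C (Suc 0) = C"
| "nested_out n C (Suc (Suc k)) =
     overlap_add_mat n (n ^ Suc k) * (C \<otimes>\<^sub>K nested_out n C (Suc k))"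

definition nested_conv ::
  "nat \<Rightarrow> complex mat \<Rightarrow> complex mat \<Rightarrow> complex mat \<Rightarrow> nat \<Rightarrow> complex vec \<Rightarrow> complex vec \<Rightarrow> complex vec"
  where
  "nested_conv n A B C d = bilinear_eval (nested_in A d) (nested_in B d) (nested_out n C d)"

end

theory Submission
  imports Defs "HOL-Analysis.Convex"
begin

text \<open>The computed result \<open>y\<close> is bilinear in the two inputs, so the error splits exactly:
  \<open>\<delta>y = y(\<delta>f, g) + y(f, \<delta>g) + y(\<delta>f, \<delta>g)\<close> (\<open>bilinear_eval_perturb\<close>). If
  \<open>\<parallel>y(u, v)\<parallel> \<le> S \<parallel>u\<parallel> \<parallel>v\<parallel>\<close>, the first two terms contribute \<open>2 S \<parallel>f\<parallel> \<parallel>g\<parallel> \<epsilon>\<close>, and the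
  third one \<open>S \<parallel>f\<parallel> \<parallel>g\<parallel> \<epsilon>\<^sup>2\<close>, which is the remainder.

  Any bilinear algorithm has such a constant, namely the product of operator norm bounds for its
  three matrices (\<open>vec_norm2_bilinear_eval_le\<close>): the Euclidean norm is submultiplicative for the
  entrywise product, and transposition preserves the spectral norm. It remains to bound the
  nested matrices. A Kronecker product has norm at most the product of the norms
  (\<open>op_norm_le_kronecker\<close>), which gives the \<open>d\<close>-th powers. Each overlap-add step costs a factor
  \<open>\<surd>2\<close> (\<open>op_norm_le_overlap_add_mat\<close>): its matrix places blocks of length \<open>2\<eta> - 1\<close> at
  multiples of \<open>\<eta>\<close>, so at most two blocks meet in any output entry. There are \<open>d - 1\<close> such steps,
  hence \<open>S\<close> can be taken as \<open>2\<^bsup>d/2\<^esup> \<parallel>C\<parallel>\<^sup>d \<parallel>A\<parallel>\<^sup>d \<parallel>B\<parallel>\<^sup>d\<close>.\<close>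

section \<open>Euclidean norm of coordinate vectors\<close>

lemma vec_norm2_nonneg: "0 \<le> vec_norm2 v"
  by (simp add: vec_norm2_def)

lemma vec_norm2_power2: "(vec_norm2 v)\<^sup>2 = (\<Sum>i<dim_vec v. (norm (v $ i))\<^sup>2)"
  by (simp add: vec_norm2_def L2_set_def sum_nonneg)

lemma vec_norm2_add:
  fixes u v :: "'a :: real_normed_vector vec"
  assumes "u \<in> carrier_vec m" "v \<in> carrier_vec m"
  shows "vec_norm2 (u + v) \<le> vec_norm2 u + vec_norm2 v"
proof -
  have "vec_norm2 (u + v) \<le> L2_set (\<lambda>i. norm (u $ i) + norm (v $ i)) {..<m}"
    using assms by (auto simp: vec_norm2_def intro!: L2_set_mono norm_triangle_ineq)
  also have "\<dots> \<le> L2_set (\<lambda>i. norm (u $ i)) {..<m} + L2_set (\<lambda>i. norm (v $ i)) {..<m}"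
    by (rule L2_set_triangle_ineq)
  finally show ?thesis using assms by (simp add: vec_norm2_def)
qed

lemma vec_norm2_smult:
  fixes v :: "complex vec"
  shows "vec_norm2 (a \<cdot>\<^sub>v v) = cmod a * vec_norm2 v"
  by (simp add: vec_norm2_def norm_mult L2_set_right_distrib cong: L2_set_cong_simp)

lemma norm_scalar_prod_le:
  fixes u v :: "complex vec"
  assumes "dim_vec u = dim_vec v"
  shows "cmod (u \<bullet> v) \<le> vec_norm2 u * vec_norm2 v"
proof -
  have "cmod (u \<bullet> v) \<le> (\<Sum>i<dim_vec v. \<bar>cmod (u $ i)\<bar> * \<bar>cmod (v $ i)\<bar>)"
    unfolding scalar_prod_def lessThan_atLeast0 by (rule sum_norm_le) (simp add: norm_mult)
  also have "\<dots> \<le> vec_norm2 u * vec_norm2 v"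
    unfolding vec_norm2_def assms by (rule L2_set_mult_ineq)
  finally show ?thesis .
qed

lemma vec_norm2_hadamard_le:
  fixes u v :: "complex vec"
  assumes "dim_vec u = dim_vec v"
  shows "vec_norm2 (u \<odot> v) \<le> vec_norm2 u * vec_norm2 v"
proof (rule power2_le_imp_le)
  have "(vec_norm2 (u \<odot> v))\<^sup>2 = (\<Sum>i<dim_vec v. (cmod (u $ i))\<^sup>2 * (cmod (v $ i))\<^sup>2)"
    by (simp add: vec_norm2_power2 hadamard_def norm_mult power_mult_distrib assms)
  also have "\<dots> \<le> (\<Sum>i<dim_vec v. (cmod (u $ i))\<^sup>2 * (vec_norm2 v)\<^sup>2)"
  proof (rule sum_mono, rule mult_left_mono)
    fix i assume "i \<in> {..<dim_vec v}"
    then show "(cmod (v $ i))\<^sup>2 \<le> (vec_norm2 v)\<^sup>2"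
      unfolding vec_norm2_power2 by (intro member_le_sum) auto
  qed simp
  also have "\<dots> = (vec_norm2 u * vec_norm2 v)\<^sup>2"
    by (simp add: vec_norm2_power2[of u] assms sum_distrib_right power_mult_distrib)
  finally show "(vec_norm2 (u \<odot> v))\<^sup>2 \<le> (vec_norm2 u * vec_norm2 v)\<^sup>2" .
qed (simp add: vec_norm2_nonneg)

section \<open>Upper bounds for the operator norm\<close>

text \<open>Stating norm bounds pointwise lets them be composed without handling the supremum in
  \<open>spectral_norm\<close>.\<close>

definition op_norm_le :: "complex mat \<Rightarrow> real \<Rightarrow> bool" where
  "op_norm_le M c \<longleftrightarrow>
     0 \<le> c \<and> (\<forall>v \<in> carrier_vec (dim_col M). vec_norm2 (M *\<^sub>v v) \<le> c * vec_norm2 v)"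

lemma op_norm_leD:
  assumes "op_norm_le M c" "v \<in> carrier_vec (dim_col M)"
  shows "vec_norm2 (M *\<^sub>v v) \<le> c * vec_norm2 v"
  using assms by (simp add: op_norm_le_def)

lemma op_norm_le_power2D:
  assumes "op_norm_le M c" "v \<in> carrier_vec (dim_col M)"
  shows "(\<Sum>i<dim_row M. (cmod (\<Sum>j<dim_col M. M $$ (i, j) * v $ j))\<^sup>2)
    \<le> c\<^sup>2 * (\<Sum>j<dim_col M. (cmod (v $ j))\<^sup>2)"
proof -
  have "(vec_norm2 (M *\<^sub>v v))\<^sup>2 \<le> (c * vec_norm2 v)\<^sup>2"
    by (intro power_mono op_norm_leD assms vec_norm2_nonneg)
  then show ?thesis using assms(2)
    by (simp add: vec_norm2_power2 power_mult_distrib scalar_prod_def lessThan_atLeast0)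
qed

lemma op_norm_le_mono:
  assumes "op_norm_le M c" "c \<le> c'"
  shows "op_norm_le M c'"
  using assms unfolding op_norm_le_def
  by (meson mult_right_mono order_trans vec_norm2_nonneg)

lemma op_norm_le_mult:
  assumes "op_norm_le M c" "op_norm_le N c'" "dim_col M = dim_row N"
  shows "op_norm_le (M * N) (c * c')"
  unfolding op_norm_le_def
proof (intro conjI ballI)
  show "0 \<le> c * c'" using assms by (simp add: op_norm_le_def)
next
  fix v :: "complex vec" assume v: "v \<in> carrier_vec (dim_col (M * N))"
  have "(M * N) *\<^sub>v v = M *\<^sub>v (N *\<^sub>v v)"
    using v assms(3) by (intro assoc_mult_mat_vec[of _ "dim_row M" "dim_row N" _ "dim_col N"]) auto
  moreover have "vec_norm2 (M *\<^sub>v (N *\<^sub>v v)) \<le> c * vec_norm2 (N *\<^sub>v v)"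
    using assms by (intro op_norm_leD) (auto intro: carrier_vecI)
  moreover have "c * vec_norm2 (N *\<^sub>v v) \<le> c * (c' * vec_norm2 v)"
    using assms v by (intro mult_left_mono op_norm_leD) (auto simp: op_norm_le_def)
  ultimately show "vec_norm2 (M * N *\<^sub>v v) \<le> c * c' * vec_norm2 v"
    by simp
qed

text \<open>The Frobenius norm is a bound, by the Cauchy-Schwarz inequality in each row. This makes the
  set in the definition of \<open>spectral_norm\<close> bounded above, without which its supremum would be
  meaningless.\<close>

lemma op_norm_le_exists: "\<exists>c. op_norm_le M c"
proof
  let ?c = "L2_set (\<lambda>i. vec_norm2 (row M i)) {..<dim_row M}"
  show "op_norm_le M ?c"
    unfolding op_norm_le_def
  proof (intro conjI ballI)
    fix v :: "complex vec" assume v: "v \<in> carrier_vec (dim_col M)"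
    have "vec_norm2 (M *\<^sub>v v) = L2_set (\<lambda>i. cmod (row M i \<bullet> v)) {..<dim_row M}"
      unfolding vec_norm2_def by (intro L2_set_cong) auto
    also have "\<dots> \<le> L2_set (\<lambda>i. vec_norm2 (row M i) * vec_norm2 v) {..<dim_row M}"
      using v by (intro L2_set_mono norm_scalar_prod_le) auto
    also have "\<dots> = ?c * vec_norm2 v"
      by (simp add: L2_set_left_distrib vec_norm2_nonneg)
    finally show "vec_norm2 (M *\<^sub>v v) \<le> ?c * vec_norm2 v" .
  qed simp
qed

text \<open>The supremum over the unit ball bounds every vector by scaling it to norm \<open>1\<close>.\<close>

lemma op_norm_le_spectral_norm: "op_norm_le M (spectral_norm M)"
proof -
  let ?S = "{v \<in> carrier_vec (dim_col M). vec_norm2 v \<le> 1}"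
  obtain c where c: "op_norm_le M c" using op_norm_le_exists by blast
  have bdd: "bdd_above ((\<lambda>v. vec_norm2 (M *\<^sub>v v)) ` ?S)"
  proof (rule bdd_aboveI2)
    fix v :: "complex vec" assume v: "v \<in> ?S"
    have "vec_norm2 (M *\<^sub>v v) \<le> c * vec_norm2 v" using c v by (intro op_norm_leD) auto
    also have "\<dots> \<le> c * 1" using c v by (intro mult_left_mono) (auto simp: op_norm_le_def)
    finally show "vec_norm2 (M *\<^sub>v v) \<le> c" by simp
  qed
  have upper: "vec_norm2 (M *\<^sub>v v) \<le> spectral_norm M"
    if "v \<in> carrier_vec (dim_col M)" "vec_norm2 v \<le> 1" for v :: "complex vec"
    unfolding spectral_norm_def using that by (intro cSUP_upper bdd) auto
  have "vec_norm2 (0\<^sub>v (dim_col M) :: complex vec) \<le> 1"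
    by (simp add: vec_norm2_def L2_set_def)
  then have nonneg: "0 \<le> spectral_norm M"
    using upper[of "0\<^sub>v (dim_col M)"] vec_norm2_nonneg order_trans by auto
  have "vec_norm2 (M *\<^sub>v v) \<le> spectral_norm M * vec_norm2 v"
    if v: "v \<in> carrier_vec (dim_col M)" for v :: "complex vec"
  proof (cases "vec_norm2 v = 0")
    case True
    then show ?thesis using op_norm_leD[OF c v] by simp
  next
    case False
    then have pos: "0 < vec_norm2 v" using vec_norm2_nonneg[of v] by simp
    let ?a = "complex_of_real (inverse (vec_norm2 v))"
    have norm_a: "cmod ?a = inverse (vec_norm2 v)"
      unfolding norm_of_real using pos by simp
    have "vec_norm2 (M *\<^sub>v (?a \<cdot>\<^sub>v v)) \<le> spectral_norm M"
      using v pos by (intro upper) (simp_all add: vec_norm2_smult norm_a del: of_real_inverse)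
    moreover have "M *\<^sub>v (?a \<cdot>\<^sub>v v) = ?a \<cdot>\<^sub>v (M *\<^sub>v v)"
      using v by (intro mult_mat_vec[of _ "dim_row M" "dim_col M"]) auto
    ultimately have "inverse (vec_norm2 v) * vec_norm2 (M *\<^sub>v v) \<le> spectral_norm M"
      by (simp only: vec_norm2_smult norm_a)
    then show ?thesis
      using pos by (simp add: field_simps)
  qed
  with nonneg show ?thesis by (simp add: op_norm_le_def)
qed

lemma spectral_norm_nonneg: "0 \<le> spectral_norm M"
  using op_norm_le_spectral_norm by (simp add: op_norm_le_def)

text \<open>Duality: with \<open>u = M\<^sup>T v\<close>, the square \<open>\<parallel>u\<parallel>\<^sup>2\<close> is the pairing of \<open>u\<close> with its conjugate \<open>w\<close>,
  and moving \<open>M\<close> to the other side gives \<open>\<parallel>u\<parallel>\<^sup>2 = \<bar>v \<bullet> M w\<bar> \<le> \<parallel>v\<parallel> c \<parallel>u\<parallel>\<close>. The pairing \<open>\<bullet>\<close> is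
  bilinear rather than sesquilinear, which is why the conjugation appears on the vector and the
  matrix is transposed without conjugation.\<close>

lemma op_norm_le_transpose:
  assumes "op_norm_le M c"
  shows "op_norm_le (transpose_mat M) c"
  unfolding op_norm_le_def
proof (intro conjI ballI)
  show c: "0 \<le> c" using assms by (simp add: op_norm_le_def)
  fix v :: "complex vec" assume "v \<in> carrier_vec (dim_col (transpose_mat M))"
  then have v: "v \<in> carrier_vec (dim_row M)" by simp
  define u where "u = transpose_mat M *\<^sub>v v"
  define w where "w = map_vec cnj u"
  have u: "u \<in> carrier_vec (dim_col M)" and w: "w \<in> carrier_vec (dim_col M)"
    by (auto simp: u_def w_def intro!: carrier_vecI)
  have norm_w: "vec_norm2 w = vec_norm2 u"
    unfolding w_def vec_norm2_def by (intro L2_set_cong) auto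
  have "u \<bullet> w = v \<bullet> (M *\<^sub>v w)"
    unfolding u_def using v w
    by (metis carrier_matI transpose_vec_mult_scalar)
  moreover have "u \<bullet> w = complex_of_real ((vec_norm2 u)\<^sup>2)"
    by (simp add: scalar_prod_def w_def vec_norm2_power2 lessThan_atLeast0
        complex_norm_square[simplified of_real_power])
  ultimately have "(vec_norm2 u)\<^sup>2 = cmod (v \<bullet> (M *\<^sub>v w))"
    by (metis abs_of_nonneg norm_of_real zero_le_power2)
  also have "\<dots> \<le> vec_norm2 v * vec_norm2 (M *\<^sub>v w)"
    using v by (intro norm_scalar_prod_le) auto
  also have "\<dots> \<le> vec_norm2 v * (c * vec_norm2 u)"
    unfolding norm_w[symmetric]
    by (intro mult_left_mono op_norm_leD assms w vec_norm2_nonneg)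
  finally have "vec_norm2 u * vec_norm2 u \<le> (c * vec_norm2 v) * vec_norm2 u"
    by (simp add: power2_eq_square mult_ac)
  then show "vec_norm2 (transpose_mat M *\<^sub>v v) \<le> c * vec_norm2 v"
    unfolding u_def[symmetric] using c vec_norm2_nonneg[of u] vec_norm2_nonneg[of v]
    by (cases "vec_norm2 u = 0") (auto dest: mult_right_le_imp_le)
qed

section \<open>Kronecker products\<close>

lemma sum_lessThan_mult:
  fixes h :: "nat \<Rightarrow> 'a :: comm_monoid_add"
  shows "(\<Sum>i<m * n. h i) = (\<Sum>p<m. \<Sum>q<n. h (p * n + q))"
proof (induction m)
  case (Suc m)
  have "(\<Sum>i<Suc m * n. h i) = (\<Sum>i<m * n + n. h i)" by (simp add: add.commute)
  also have "\<dots> = (\<Sum>i<m * n. h i) + (\<Sum>q<n. h (m * n + q))"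
    using sum.atLeastLessThan_concat[of 0 "m * n" "m * n + n" h]
      sum.shift_bounds_nat_ivl[of h 0 "m * n" n]
    by (simp add: lessThan_atLeast0 add.commute)
  finally show ?case using Suc by simp
qed simp

lemma row_major_index_less: "p * n + q < m * n" if "p < m" "q < n" for p q m n :: nat
proof -
  have "p * n + q < Suc p * n" using that by simp
  also have "\<dots> \<le> m * n" using that by (intro mult_le_mono1) simp
  finally show ?thesis .
qed

text \<open>Read \<open>x\<close> as a matrix \<open>X\<close>, row by row. Then \<open>M \<otimes>\<^sub>K N\<close> first applies \<open>N\<close> to every row of \<open>X\<close>,
  giving \<open>Z\<close>, and then \<open>M\<close> to every column of \<open>Z\<close>. Either step multiplies the sum of the squared
  entries by at most \<open>b\<^sup>2\<close> or \<open>a\<^sup>2\<close>.\<close>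

lemma op_norm_le_kronecker:
  assumes M: "op_norm_le M a" and N: "op_norm_le N b"
  shows "op_norm_le (M \<otimes>\<^sub>K N) (a * b)"
  unfolding op_norm_le_def
proof (intro conjI ballI)
  show ab: "0 \<le> a * b" using assms by (simp add: op_norm_le_def)
  fix x :: "complex vec" assume "x \<in> carrier_vec (dim_col (M \<otimes>\<^sub>K N))"
  then have x: "dim_vec x = dim_col M * dim_col N" by (simp add: kronecker_def)
  define m n m' n' where "m = dim_row M" "n = dim_row N" "m' = dim_col M" "n' = dim_col N"
  note dims = m_n_m'_n'_def
  define X where "X p q = x $ (p * n' + q)" for p q
  define Z where "Z p i = (\<Sum>q<n'. N $$ (i, q) * X p q)" for p i
  have entry: "(M \<otimes>\<^sub>K N *\<^sub>v x) $ (k * n + i) = (\<Sum>p<m'. M $$ (k, p) * Z p i)"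
    if k: "k < m" and i: "i < n" for k i
  proof -
    have less: "k * n + i < m * n"
      using k i by (rule row_major_index_less)
    have "(M \<otimes>\<^sub>K N *\<^sub>v x) $ (k * n + i) = (\<Sum>j<m' * n'. (M \<otimes>\<^sub>K N) $$ (k * n + i, j) * x $ j)"
      using less x by (simp add: kronecker_def scalar_prod_def dims lessThan_atLeast0)
    also have "\<dots> = (\<Sum>p<m'. \<Sum>q<n'. M $$ (k, p) * (N $$ (i, q) * X p q))"
      unfolding sum_lessThan_mult
    proof (intro sum.cong refl)
      fix p q assume "p \<in> {..<m'}" "q \<in> {..<n'}"
      then have p: "p < m'" and q: "q < n'" by auto
      have "p * n' + q < m' * n'" using p q by (rule row_major_index_less)
      then show "(M \<otimes>\<^sub>K N) $$ (k * n + i, p * n' + q) * x $ (p * n' + q)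
          = M $$ (k, p) * (N $$ (i, q) * X p q)"
        using less i q by (simp add: kronecker_def dims X_def)
    qed
    finally show ?thesis by (simp add: Z_def sum_distrib_left)
  qed
  have "dim_vec (M \<otimes>\<^sub>K N *\<^sub>v x) = m * n" by (simp add: kronecker_def dims)
  then have "(vec_norm2 (M \<otimes>\<^sub>K N *\<^sub>v x))\<^sup>2
      = (\<Sum>k<m. \<Sum>i<n. (cmod ((M \<otimes>\<^sub>K N *\<^sub>v x) $ (k * n + i)))\<^sup>2)"
    by (simp only: vec_norm2_power2 sum_lessThan_mult)
  also have "\<dots> = (\<Sum>k<m. \<Sum>i<n. (cmod (\<Sum>p<m'. M $$ (k, p) * Z p i))\<^sup>2)"
    by (intro sum.cong refl) (simp add: entry)
  also have "\<dots> = (\<Sum>i<n. \<Sum>k<m. (cmod (\<Sum>p<m'. M $$ (k, p) * Z p i))\<^sup>2)"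
    by (rule sum.swap)
  also have "\<dots> \<le> (\<Sum>i<n. a\<^sup>2 * (\<Sum>p<m'. (cmod (Z p i))\<^sup>2))"
    using op_norm_le_power2D[OF M, of "vec m' (\<lambda>p. Z p i)" for i]
    by (intro sum_mono) (simp add: dims)
  also have "\<dots> = a\<^sup>2 * (\<Sum>p<m'. \<Sum>i<n. (cmod (Z p i))\<^sup>2)"
    unfolding sum_distrib_left[symmetric] by (subst sum.swap) (rule refl)
  also have "\<dots> \<le> a\<^sup>2 * (\<Sum>p<m'. b\<^sup>2 * (\<Sum>q<n'. (cmod (X p q))\<^sup>2))"
    using op_norm_le_power2D[OF N, of "vec n' (\<lambda>q. X p q)" for p]
    by (intro mult_left_mono sum_mono) (simp_all add: dims Z_def)
  also have "\<dots> = (a * b * vec_norm2 x)\<^sup>2"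
    unfolding power_mult_distrib vec_norm2_power2 x sum_lessThan_mult X_def dims
    by (simp add: sum_distrib_left mult_ac)
  finally show "vec_norm2 (M \<otimes>\<^sub>K N *\<^sub>v x) \<le> a * b * vec_norm2 x"
    by (rule power2_le_imp_le) (simp add: ab vec_norm2_nonneg)
qed

section \<open>Overlap-add recomposition\<close>

text \<open>Column \<open>j = (2\<eta> - 1) q + r\<close>, that is, position \<open>r\<close> of block \<open>q\<close>, is sent to row
  \<open>i = \<eta> q + r\<close>. Since \<open>r \<le> 2\<eta> - 2 < 2\<eta>\<close>, block \<open>q\<close> reaches row \<open>i\<close> only if \<open>q\<close> is \<open>i div \<eta>\<close> or
  its predecessor, and \<open>i\<close> and \<open>q\<close> determine \<open>j\<close>.\<close>

lemma card_overlap_add_row_le: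
  fixes \<eta> N i :: nat
  assumes "1 \<le> \<eta>"
  shows "card {j. j < N \<and> i = j - (\<eta> - 1) * (j div (2 * \<eta> - 1))} \<le> 2" (is "card ?S \<le> 2")
proof -
  have "?S \<subseteq> (\<lambda>q. (2 * \<eta> - 1) * q + (i - \<eta> * q)) ` {i div \<eta> - 1, i div \<eta>}"
  proof
    fix j assume "j \<in> ?S"
    then have i: "i = j - (\<eta> - 1) * (j div (2 * \<eta> - 1))" by simp
    define q r where "q = j div (2 * \<eta> - 1)" and "r = j mod (2 * \<eta> - 1)"
    have j: "j = (2 * \<eta> - 1) * q + r" by (simp add: q_def r_def)
    have r: "r < 2 * \<eta> - 1" using assms by (simp add: r_def)
    \<comment> \<open>Substituting \<open>\<eta> = e + 1\<close> removes the truncated subtractions.\<close>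
    obtain e where e: "\<eta> = Suc e" using assms by (cases \<eta>) auto
    have iq: "i = \<eta> * q + r"
      unfolding i q_def[symmetric] using j by (simp add: e algebra_simps)
    have "q \<le> i div \<eta>" "i div \<eta> < q + 2"
      using assms r by (auto simp: iq less_eq_div_iff_mult_less_eq div_less_iff_less_mult algebra_simps)
    then have "q \<in> {i div \<eta> - 1, i div \<eta>}" by auto
    then show "j \<in> (\<lambda>q. (2 * \<eta> - 1) * q + (i - \<eta> * q)) ` {i div \<eta> - 1, i div \<eta>}"
      by (rule rev_image_eqI) (simp add: iq j)
  qed
  then have "card ?S \<le> card {i div \<eta> - 1, i div \<eta>}"
    by (meson card_image_le card_mono finite.emptyI finite.insertI finite_imageI order_trans)
  also have "\<dots> \<le> 2" by (simp add: card_insert_if)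
  finally show ?thesis .
qed

text \<open>An output entry is a sum of at most two input entries, so its square is at most twice the sum
  of their squares. Every input entry is used at most once, because each column has at most one
  nonzero entry; summing over the rows therefore yields at most \<open>2 \<parallel>x\<parallel>\<^sup>2\<close>.\<close>

lemma op_norm_le_overlap_add_mat:
  assumes "1 \<le> \<eta>"
  shows "op_norm_le (overlap_add_mat \<gamma> \<eta>) (sqrt 2)"
  unfolding op_norm_le_def
proof (intro conjI ballI)
  let ?Q = "overlap_add_mat \<gamma> \<eta> :: complex mat"
  define L where "L = 2 * \<gamma> * \<eta> - 1"
  define N where "N = (2 * \<gamma> - 1) * (2 * \<eta> - 1)"
  define \<phi> where "\<phi> j = j - (\<eta> - 1) * (j div (2 * \<eta> - 1))" for j :: nat
  fix x :: "complex vec" assume "x \<in> carrier_vec (dim_col ?Q)"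
  then have x: "dim_vec x = N" by (simp add: overlap_add_mat_def N_def)
  have entry: "(?Q *\<^sub>v x) $ i = (\<Sum>j | j < N \<and> i = \<phi> j. x $ j)" if "i < L" for i
  proof -
    have "(?Q *\<^sub>v x) $ i = (\<Sum>j<N. if i = \<phi> j then x $ j else 0)"
      using that x
      by (auto simp: overlap_add_mat_def scalar_prod_def lessThan_atLeast0 L_def N_def \<phi>_def
          simp del: One_nat_def intro!: sum.cong)
    then show ?thesis by (simp add: sum.inter_filter[symmetric])
  qed
  have "(vec_norm2 (?Q *\<^sub>v x))\<^sup>2 = (\<Sum>i<L. (cmod (\<Sum>j | j < N \<and> i = \<phi> j. x $ j))\<^sup>2)"
  proof -
    have "dim_vec (?Q *\<^sub>v x) = L" by (simp add: L_def overlap_add_mat_def)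
    then show ?thesis by (simp add: vec_norm2_power2 entry del: index_mult_mat_vec)
  qed
  also have "\<dots> \<le> (\<Sum>i<L. 2 * (\<Sum>j | j < N \<and> i = \<phi> j. (cmod (x $ j))\<^sup>2))"
  proof (rule sum_mono)
    fix i
    let ?S = "{j. j < N \<and> i = \<phi> j}"
    have "(cmod (\<Sum>j\<in>?S. x $ j))\<^sup>2 \<le> (\<Sum>j\<in>?S. cmod (x $ j))\<^sup>2"
      by (intro power_mono norm_sum) simp
    also have "\<dots> \<le> (\<Sum>j\<in>?S. (cmod (x $ j))\<^sup>2) * real (card ?S)"
      by (rule sum_squared_le_sum_of_squares)
    also have "\<dots> \<le> (\<Sum>j\<in>?S. (cmod (x $ j))\<^sup>2) * 2"
      using card_overlap_add_row_le[OF assms, of N i]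
      by (intro mult_left_mono) (auto simp: \<phi>_def sum_nonneg)
    finally show "(cmod (\<Sum>j\<in>?S. x $ j))\<^sup>2 \<le> 2 * (\<Sum>j\<in>?S. (cmod (x $ j))\<^sup>2)" by simp
  qed
  also have "\<dots> = 2 * (\<Sum>j<N. \<Sum>i<L. if i = \<phi> j then (cmod (x $ j))\<^sup>2 else 0)"
  proof -
    have "(\<Sum>j | j < N \<and> i = \<phi> j. (cmod (x $ j))\<^sup>2)
        = (\<Sum>j<N. if i = \<phi> j then (cmod (x $ j))\<^sup>2 else 0)" for i
      by (simp add: sum.inter_filter[symmetric])
    then show ?thesis
      unfolding sum_distrib_left[symmetric] by (subst sum.swap) simp
  qed
  also have "\<dots> \<le> 2 * (\<Sum>j<N. (cmod (x $ j))\<^sup>2)"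
    by (intro mult_left_mono sum_mono) auto
  also have "\<dots> = (sqrt 2 * vec_norm2 x)\<^sup>2"
    by (simp add: power_mult_distrib vec_norm2_power2 x)
  finally show "vec_norm2 (?Q *\<^sub>v x) \<le> sqrt 2 * vec_norm2 x"
    by (rule power2_le_imp_le) (simp add: vec_norm2_nonneg)
qed simp

section \<open>Nested algorithms and perturbation of their inputs\<close>

lemma nested_in_carrier:
  assumes "M \<in> carrier_mat n R"
  shows "nested_in M (Suc k) \<in> carrier_mat (n ^ Suc k) (R ^ Suc k)"
  using assms by (induction k) (auto simp: kronecker_def)

lemma nested_out_carrier:
  assumes "M \<in> carrier_mat (2 * n - 1) R"
  shows "nested_out n M (Suc k) \<in> carrier_mat (2 * n ^ Suc k - 1) (R ^ Suc k)"
  using assms by (induction k) (auto simp: kronecker_def overlap_add_mat_def mult_ac)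

lemma op_norm_le_nested_in: "op_norm_le (nested_in M (Suc k)) (spectral_norm M ^ Suc k)"
proof (induction k)
  case 0
  then show ?case by (simp add: op_norm_le_spectral_norm)
next
  case (Suc k)
  show ?case using op_norm_le_kronecker[OF op_norm_le_spectral_norm Suc.IH] by simp
qed

text \<open>Level \<open>k + 1\<close> involves only \<open>k\<close> recompositions, hence the exponent of \<open>\<surd>2\<close>.\<close>

lemma op_norm_le_nested_out:
  assumes "1 \<le> n" and C: "C \<in> carrier_mat (2 * n - 1) R"
  shows "op_norm_le (nested_out n C (Suc k)) (sqrt 2 ^ k * spectral_norm C ^ Suc k)"
proof (induction k)
  case 0
  then show ?case by (simp add: op_norm_le_spectral_norm)
next
  case (Suc k)
  have "op_norm_le (nested_out n C (Suc (Suc k)))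
      (sqrt 2 * (spectral_norm C * (sqrt 2 ^ k * spectral_norm C ^ Suc k)))"
    unfolding nested_out.simps
    using C nested_out_carrier[OF C, of k] assms(1)
    by (intro op_norm_le_mult op_norm_le_kronecker op_norm_le_overlap_add_mat
        op_norm_le_spectral_norm Suc.IH) (auto simp: kronecker_def overlap_add_mat_def)
  then show ?case by (simp add: mult_ac)
qed

lemma vec_norm2_bilinear_eval_le:
  assumes "A \<in> carrier_mat m R" "B \<in> carrier_mat m R" "C \<in> carrier_mat l R"
    and "op_norm_le A a" "op_norm_le B b" "op_norm_le C c"
    and "u \<in> carrier_vec m" "v \<in> carrier_vec m"
  shows "vec_norm2 (bilinear_eval A B C u v) \<le> c * a * b * vec_norm2 u * vec_norm2 v"
proof -
  let ?p = "transpose_mat A *\<^sub>v u" and ?q = "transpose_mat B *\<^sub>v v"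
  have nonneg: "0 \<le> a" "0 \<le> c" using assms by (auto simp: op_norm_le_def)
  have "vec_norm2 (bilinear_eval A B C u v) \<le> c * vec_norm2 (?p \<odot> ?q)"
    unfolding bilinear_eval_def using assms by (intro op_norm_leD) (auto simp: hadamard_def)
  also have "\<dots> \<le> c * (vec_norm2 ?p * vec_norm2 ?q)"
    using assms nonneg by (intro mult_left_mono vec_norm2_hadamard_le) auto
  also have "\<dots> \<le> c * ((a * vec_norm2 u) * (b * vec_norm2 v))"
    using assms nonneg vec_norm2_nonneg
    by (intro mult_left_mono mult_mono op_norm_leD op_norm_le_transpose) auto
  finally show ?thesis by (simp add: mult_ac)
qed

lemma bilinear_eval_perturb:
  assumes A: "A \<in> carrier_mat m R" and B: "B \<in> carrier_mat m R" and C: "C \<in> carrier_mat l R"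
    and f: "f \<in> carrier_vec m" "f' \<in> carrier_vec m" and g: "g \<in> carrier_vec m" "g' \<in> carrier_vec m"
  shows "bilinear_eval A B C (f + f') (g + g') - bilinear_eval A B C f g
    = bilinear_eval A B C f' g + (bilinear_eval A B C f g' + bilinear_eval A B C f' g')"
proof -
  let ?At = "transpose_mat A" and ?Bt = "transpose_mat B"
  let ?h = "\<lambda>u v. (?At *\<^sub>v u) \<odot> (?Bt *\<^sub>v v)"
  have h: "?h u v \<in> carrier_vec R" for u v using A by (auto simp: hadamard_def)
  have At: "?At \<in> carrier_mat R m" and Bt: "?Bt \<in> carrier_mat R m" using A B by auto
  have "?h (f + f') (g + g') = ?h f g + (?h f' g + (?h f g' + ?h f' g'))"
    unfolding mult_add_distrib_mat_vec[OF At f] mult_add_distrib_mat_vec[OF Bt g]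
    using A B by (intro eq_vecI) (auto simp: hadamard_def algebra_simps)
  then have "bilinear_eval A B C (f + f') (g + g') = bilinear_eval A B C f g
      + (bilinear_eval A B C f' g + (bilinear_eval A B C f g' + bilinear_eval A B C f' g'))"
    unfolding bilinear_eval_def using h
    by (simp add: mult_add_distrib_mat_vec[OF C])
  then show ?thesis
    using C by (auto simp: bilinear_eval_def)
qed

theorem theorem9p3:
  fixes n d R :: nat
    and A B C :: "complex mat"
    and f\<^sub>0 g\<^sub>0 :: "real vec"
  defines "f \<equiv> map_vec complex_of_real f\<^sub>0"
    and "g \<equiv> map_vec complex_of_real g\<^sub>0"
  assumes "n \<ge> 1" and "d \<ge> 1"
    and "lin_conv_algorithm n R A B C"
    and "f\<^sub>0 \<in> carrier_vec (n ^ d)" and "g\<^sub>0 \<in> carrier_vec (n ^ d)"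
  shows "\<exists>r :: real \<Rightarrow> real. r \<in> O[at_right 0](\<lambda>\<epsilon>. \<epsilon>\<^sup>2) \<and>
    (\<forall>\<epsilon> > 0. \<forall>\<delta>f \<in> carrier_vec (n ^ d). \<forall>\<delta>g \<in> carrier_vec (n ^ d).
       vec_norm2 \<delta>f \<le> \<epsilon> * vec_norm2 f \<longrightarrow> vec_norm2 \<delta>g \<le> \<epsilon> * vec_norm2 g \<longrightarrow>
       vec_norm2 (nested_conv n A B C d (f + \<delta>f) (g + \<delta>g) - nested_conv n A B C d f g)
         \<le> 2 powr (real d / 2 + 1) * spectral_norm C ^ d * spectral_norm A ^ d * spectral_norm B ^ d
             * vec_norm2 f * vec_norm2 g * \<epsilon> + r \<epsilon>)"
proof -
  obtain k where d: "d = Suc k" using \<open>d \<ge> 1\<close> by (cases d) auto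
  have carriers: "A \<in> carrier_mat n R" "B \<in> carrier_mat n R" "C \<in> carrier_mat (2 * n - 1) R"
    using assms(5) by (auto simp: lin_conv_algorithm_def)
  define K where "K = spectral_norm C ^ d * spectral_norm A ^ d * spectral_norm B ^ d"
  define S where "S = sqrt 2 ^ d * K"
  have S: "0 \<le> S" by (auto simp: K_def S_def spectral_norm_nonneg)
  have f: "f \<in> carrier_vec (n ^ d)" and g: "g \<in> carrier_vec (n ^ d)"
    using assms by auto
  let ?y = "nested_conv n A B C d"
  have nested_carriers: "nested_in A d \<in> carrier_mat (n ^ d) (R ^ d)"
    "nested_in B d \<in> carrier_mat (n ^ d) (R ^ d)"
    "nested_out n C d \<in> carrier_mat (2 * n ^ d - 1) (R ^ d)"
    unfolding d using carriers by (intro nested_in_carrier nested_out_carrier; simp)+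
  \<comment> \<open>The \<open>d - 1 = k\<close> recompositions give \<open>(\<surd>2)\<^sup>k\<close>, which is rounded up to \<open>(\<surd>2)\<^sup>d\<close>.\<close>
  have "sqrt 2 ^ k \<le> sqrt 2 ^ Suc k" by (rule power_increasing) auto
  then have "op_norm_le (nested_out n C d) (sqrt 2 ^ d * spectral_norm C ^ d)"
    unfolding d
    by (intro op_norm_le_mono[OF op_norm_le_nested_out[OF \<open>n \<ge> 1\<close> carriers(3)]] mult_right_mono)
       (simp_all add: spectral_norm_nonneg)
  note bounds = op_norm_le_nested_in[of A k, folded d] op_norm_le_nested_in[of B k, folded d] this
  have y_le: "vec_norm2 (?y u v) \<le> S * (vec_norm2 u * vec_norm2 v)"
    if "u \<in> carrier_vec (n ^ d)" "v \<in> carrier_vec (n ^ d)" for u v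
    using vec_norm2_bilinear_eval_le[OF nested_carriers bounds that]
    by (simp add: nested_conv_def S_def K_def mult_ac)
  have y_carrier: "?y u v \<in> carrier_vec (2 * n ^ d - 1)" for u v
    using nested_carriers by (auto simp: nested_conv_def bilinear_eval_def intro: carrier_vecI)
  have powr: "2 powr (real d / 2 + 1) = 2 * sqrt 2 ^ d"
    by (simp add: powr_add powr_half_sqrt_powr powr_realpow real_sqrt_power)
  define P where "P = vec_norm2 f * vec_norm2 g"
  define r where "r \<epsilon> = S * P * \<epsilon>\<^sup>2" for \<epsilon> :: real
  have bigo: "r \<in> O[at_right 0](\<lambda>\<epsilon>. \<epsilon>\<^sup>2)" unfolding r_def by simp
  have bound: "vec_norm2 (?y (f + \<delta>f) (g + \<delta>g) - ?y f g)
         \<le> 2 powr (real d / 2 + 1) * spectral_norm C ^ d * spectral_norm A ^ d * spectral_norm B ^ d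
             * vec_norm2 f * vec_norm2 g * \<epsilon> + r \<epsilon>"
    if eps: "\<epsilon> > 0" and \<delta>f: "\<delta>f \<in> carrier_vec (n ^ d)" and \<delta>g: "\<delta>g \<in> carrier_vec (n ^ d)"
      and \<delta>f_le: "vec_norm2 \<delta>f \<le> \<epsilon> * vec_norm2 f" and \<delta>g_le: "vec_norm2 \<delta>g \<le> \<epsilon> * vec_norm2 g"
    for \<epsilon> :: real and \<delta>f \<delta>g :: "complex vec"
  proof -
    note nonneg = vec_norm2_nonneg
    have "?y (f + \<delta>f) (g + \<delta>g) - ?y f g = ?y \<delta>f g + (?y f \<delta>g + ?y \<delta>f \<delta>g)"
      unfolding nested_conv_def by (rule bilinear_eval_perturb[OF nested_carriers f \<delta>f g \<delta>g])
    then have "vec_norm2 (?y (f + \<delta>f) (g + \<delta>g) - ?y f g)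
        \<le> vec_norm2 (?y \<delta>f g) + (vec_norm2 (?y f \<delta>g) + vec_norm2 (?y \<delta>f \<delta>g))"
      using vec_norm2_add[of "?y \<delta>f g" _ "?y f \<delta>g + ?y \<delta>f \<delta>g"]
        vec_norm2_add[of "?y f \<delta>g" _ "?y \<delta>f \<delta>g"] y_carrier by fastforce
    also have "\<dots> \<le> S * (vec_norm2 \<delta>f * vec_norm2 g)
        + (S * (vec_norm2 f * vec_norm2 \<delta>g) + S * (vec_norm2 \<delta>f * vec_norm2 \<delta>g))"
      by (intro add_mono y_le f g \<delta>f \<delta>g)
    also have "\<dots> \<le> S * ((\<epsilon> * vec_norm2 f) * vec_norm2 g)
        + (S * (vec_norm2 f * (\<epsilon> * vec_norm2 g)) + S * ((\<epsilon> * vec_norm2 f) * (\<epsilon> * vec_norm2 g)))"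
      using eps by (intro add_mono mult_left_mono mult_mono \<delta>f_le \<delta>g_le S order_refl)
         (auto simp: nonneg)
    also have "\<dots> = 2 * S * P * \<epsilon> + r \<epsilon>"
      by (simp add: r_def P_def power2_eq_square algebra_simps)
    finally show ?thesis by (simp add: powr S_def K_def P_def mult_ac)
  qed
  from bigo bound show ?thesis by blast
qed

end
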